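(* Let $(M,w)$ and $(M',w')$ be collectively $\mathtt{P}$-bisimilar pointed models. Then for every $\psi\in\mathcal{L}_{!}$, $(M,w)\Vdash\psi$ if and only if $(M',w')\Vdash\psi$.
   Context: Fix a finite non-empty set of agents $A$ and a non-empty countable set of atoms $\mathtt{P}$. A model is $M=\langle W,R,V\rangle$ with $W$ non-empty, $R=\{R_i\subseteq W\times W\mid i\in A\}$ arbitrary relations, $V:\mathtt{P}\to\mathcal{P}(W)$; $R_G:=\bigcap_{k\in G}R_k$ (with $R_\emptyset:=W\times W$). $\mathcal{L}_D$: $\varphi::=p\mid\lnot\varphi\mid\varphi\land\varphi\mid D_G\varphi$ ($\emptyset\neq G\subseteq A$), with $(M,w)\Vdash D_G\varphi$ iff $\varphi$ holds at all $u$ with $(w,u)\in R_G$. $\|\xi\|^M$ is the truth set of $\xi$, $\sim^M_\xi:=(\|\xi\|^M\times\|\xi\|^M)\cup(\|\lnot\xi\|^M\times\|\lnot\xi\|^M)$, and $M^{!\xi}=\langle W,R^{!\xi},V\rangle$ with $R^{!\xi}_i:=R_i\cap\sim^M_\xi$. $\mathcal{L}_{!}$ is $\bigcup_n\mathcal{L}_!^n$ with $\mathcal{L}_!^0=\mathcal{L}_D$ and $\mathcal{L}_!^{n+1}$ extending $\mathcal{L}_!^n$ with $[\xi]\varphi$ for $\xi\in\mathcal{L}_!^n$, where $(M,w)\Vdash[\xi]\varphi$ iff $(M,w)\Vdash\xi$ implies $(M^{!\xi},w)\Vdash\varphi$. A collective $\mathtt{P}$-bisimulation between $M$ and $M'=\langle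 W',R',V'\rangle$ is a non-empty $Z\subseteq W\times W'$ such that each $(u,u')\in Z$ satisfies: same atoms; for every $G\subseteq A$ and $(u,v)\in R_G$ some $v'$ has $(u',v')\in R'_G$, $(v,v')\in Z$; and symmetrically (back). $(M,w),(M',w')$ are collectively $\mathtt{P}$-bisimilar if such a $Z$ contains $(w,w')$. *)

theory Defs
  imports Main "HOL-Library.Countable"
begin

text \<open>
  The set of agents is the universe of the type variable \<open>'a\<close>, the set of atoms that of \<open>'p\<close>
  (both non-empty, as all types are); finiteness of the former and countability of the latter are
  imposed by type classes in the theorem. The domain of a model is an explicit set.
\<close>

record ('a, 'p, 'w) model =
  worlds :: "'w set"
  rel :: "'a \<Rightarrow> ('w \<times> 'w) set"
  val :: "'p \<Rightarrow> 'w set"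

definition is_model :: "('a, 'p, 'w) model \<Rightarrow> bool" where
  "is_model M \<longleftrightarrow> worlds M \<noteq> {} \<and> (\<forall>i. rel M i \<subseteq> worlds M \<times> worlds M) \<and> (\<forall>p. val M p \<subseteq> worlds M)"

definition rel_group :: "('a, 'p, 'w) model \<Rightarrow> 'a set \<Rightarrow> ('w \<times> 'w) set" where
  "rel_group M G = (if G = {} then worlds M \<times> worlds M else (\<Inter>k\<in>G. rel M k))"

text \<open>
  \<open>Ann \<xi> \<phi>\<close> is \<open>[\<xi>]\<phi>\<close>. The datatype admits \<open>D {} \<phi>\<close>; the languages below do not.
\<close>

datatype ('a, 'p) fm =
    Atom 'p
  | Neg "('a, 'p) fm"
  | Conj "('a, 'p) fm" "('a, 'p) fm"
  | D "'a set" "('a, 'p) fm"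
  | Ann "('a, 'p) fm" "('a, 'p) fm"

inductive_set LD :: "('a, 'p) fm set" where
  "Atom p \<in> LD"
| "\<phi> \<in> LD \<Longrightarrow> Neg \<phi> \<in> LD"
| "\<phi> \<in> LD \<Longrightarrow> \<psi> \<in> LD \<Longrightarrow> Conj \<phi> \<psi> \<in> LD"
| "G \<noteq> {} \<Longrightarrow> \<phi> \<in> LD \<Longrightarrow> D G \<phi> \<in> LD"

text \<open>
  The extension of a language by announcements of formulas in \<open>X\<close>: it is again closed under all
  constructors of the grammar.
\<close>

inductive_set LExt :: "('a, 'p) fm set \<Rightarrow> ('a, 'p) fm set" for X :: "('a, 'p) fm set" where
  "Atom p \<in> LExt X"
| "\<phi> \<in> LExt X \<Longrightarrow> Neg \<phi> \<in> LExt X"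
| "\<phi> \<in> LExt X \<Longrightarrow> \<psi> \<in> LExt X \<Longrightarrow> Conj \<phi> \<psi> \<in> LExt X"
| "G \<noteq> {} \<Longrightarrow> \<phi> \<in> LExt X \<Longrightarrow> D G \<phi> \<in> LExt X"
| "\<xi> \<in> X \<Longrightarrow> \<phi> \<in> LExt X \<Longrightarrow> Ann \<xi> \<phi> \<in> LExt X"

fun LAnn_level :: "nat \<Rightarrow> ('a, 'p) fm set" where
  "LAnn_level 0 = LD"
| "LAnn_level (Suc n) = LExt (LAnn_level n)"

definition LAnn :: "('a, 'p) fm set" where
  "LAnn = (\<Union>n. LAnn_level n)"

text \<open>
  The clause for \<open>Ann\<close> spells out the updated model so that the recursion is structural; it is
  restated through \<open>announce\<close> in \<open>sat_Ann\<close> below.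
\<close>

primrec sat :: "('a, 'p) fm \<Rightarrow> ('a, 'p, 'w) model \<Rightarrow> 'w \<Rightarrow> bool" where
  "sat (Atom p) = (\<lambda>M w. w \<in> val M p)"
| "sat (Neg \<phi>) = (\<lambda>M w. \<not> sat \<phi> M w)"
| "sat (Conj \<phi> \<psi>) = (\<lambda>M w. sat \<phi> M w \<and> sat \<psi> M w)"
| "sat (D G \<phi>) = (\<lambda>M w. \<forall>u. (w, u) \<in> rel_group M G \<longrightarrow> sat \<phi> M u)"
| "sat (Ann \<xi> \<phi>) = (\<lambda>M w. sat \<xi> M w \<longrightarrow>
     sat \<phi> (M\<lparr>rel := \<lambda>i. rel M i \<inter>
       ({u \<in> worlds M. sat \<xi> M u} \<times> {u \<in> worlds M. sat \<xi> M u} \<union>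
        {u \<in> worlds M. \<not> sat \<xi> M u} \<times> {u \<in> worlds M. \<not> sat \<xi> M u})\<rparr>) w)"

definition truth_set :: "('a, 'p, 'w) model \<Rightarrow> ('a, 'p) fm \<Rightarrow> 'w set" where
  "truth_set M \<xi> = {u \<in> worlds M. sat \<xi> M u}"

definition agree :: "('a, 'p, 'w) model \<Rightarrow> ('a, 'p) fm \<Rightarrow> ('w \<times> 'w) set" where
  "agree M \<xi> = truth_set M \<xi> \<times> truth_set M \<xi> \<union> truth_set M (Neg \<xi>) \<times> truth_set M (Neg \<xi>)"

definition announce :: "('a, 'p, 'w) model \<Rightarrow> ('a, 'p) fm \<Rightarrow> ('a, 'p, 'w) model" where
  "announce M \<xi> = M\<lparr>rel := \<lambda>i. rel M i \<inter> agree M \<xi>\<rparr>"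

lemma sat_Ann: "sat (Ann \<xi> \<phi>) M w \<longleftrightarrow> (sat \<xi> M w \<longrightarrow> sat \<phi> (announce M \<xi>) w)"
  by (simp add: announce_def agree_def truth_set_def)

definition collective_bisim ::
  "('a, 'p, 'w) model \<Rightarrow> ('a, 'p, 'v) model \<Rightarrow> ('w \<times> 'v) set \<Rightarrow> bool" where
  "collective_bisim M M' Z \<longleftrightarrow>
     Z \<noteq> {} \<and> Z \<subseteq> worlds M \<times> worlds M' \<and>
     (\<forall>(u, u') \<in> Z.
        (\<forall>p. u \<in> val M p \<longleftrightarrow> u' \<in> val M' p) \<and>
        (\<forall>G v. (u, v) \<in> rel_group M G \<longrightarrow> (\<exists>v'. (u', v') \<in> rel_group M' G \<and> (v, v') \<in> Z)) \<and>
        (\<forall>G v'. (u', v') \<in> rel_group M' G \<longrightarrow> (\<exists>v. (u, v) \<in> rel_group M G \<and> (v, v') \<in> Z)))"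

definition collectively_bisimilar ::
  "('a, 'p, 'w) model \<Rightarrow> 'w \<Rightarrow> ('a, 'p, 'v) model \<Rightarrow> 'v \<Rightarrow> bool" where
  "collectively_bisimilar M w M' w' \<longleftrightarrow> (\<exists>Z. collective_bisim M M' Z \<and> (w, w') \<in> Z)"

end

theory Submission imports Defs begin

text \<open>
  Bisimulation invariance is proved by structural induction on the formula, for all models and
  bisimulations simultaneously. If \<open>\<xi>\<close> is invariant under a collective bisimulation \<open>Z\<close> between
  \<open>M\<close> and \<open>M'\<close>, then \<open>Z\<close> is still a collective bisimulation between \<open>announce M \<xi>\<close> and
  \<open>announce M' \<xi>\<close>: the update intersects every \<open>R\<^sub>G\<close> with \<open>G \<noteq> {}\<close> with the relation of agreeing
  on \<open>\<xi>\<close>, which \<open>Z\<close> respects, and leaves the total relation for the empty group unchanged.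
\<close>

lemma worlds_announce [simp]: "worlds (announce M \<xi>) = worlds M"
  by (simp add: announce_def)

lemma val_announce [simp]: "val (announce M \<xi>) = val M"
  by (simp add: announce_def)

text \<open>For \<open>G \<noteq> {}\<close> the factor \<open>agree M \<xi>\<close> is common to
  all members of the group and comes out of the intersection. The empty group is separate because
  its relation is total by definition, not an intersection of updated relations.\<close>

lemma rel_group_announce:
  "rel_group (announce M \<xi>) G = (if G = {} then worlds M \<times> worlds M else rel_group M G \<inter> agree M \<xi>)"
  by (auto simp: rel_group_def announce_def)

lemma rel_group_announce_subset: "rel_group (announce M \<xi>) G \<subseteq> rel_group M G"
  by (auto simp: rel_group_def announce_def)

lemma agree_iff:
  "(u, v) \<in> agree M \<xi> \<longleftrightarrow> u \<in> worlds M \<and> v \<in> worlds M \<and> (sat \<xi> M u \<longleftrightarrow> sat \<xi> M v)"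
  by (auto simp: agree_def truth_set_def)

lemma collective_bisimI:
  assumes "Z \<noteq> {}" and "Z \<subseteq> worlds M \<times> worlds M'"
    and "\<And>u u' p. (u, u') \<in> Z \<Longrightarrow> u \<in> val M p \<longleftrightarrow> u' \<in> val M' p"
    and "\<And>u u' v G. (u, u') \<in> Z \<Longrightarrow> (u, v) \<in> rel_group M G \<Longrightarrow>
      \<exists>v'. (u', v') \<in> rel_group M' G \<and> (v, v') \<in> Z"
    and "\<And>u u' v' G. (u, u') \<in> Z \<Longrightarrow> (u', v') \<in> rel_group M' G \<Longrightarrow>
      \<exists>v. (u, v) \<in> rel_group M G \<and> (v, v') \<in> Z"
  shows "collective_bisim M M' Z"
  unfolding collective_bisim_def
proof (intro conjI assms(1,2) ballI)
  fix x assume "x \<in> Z"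
  then obtain u u' where "x = (u, u')" "(u, u') \<in> Z"
    by (cases x) simp
  then show "case x of (u, u') \<Rightarrow>
      (\<forall>p. u \<in> val M p \<longleftrightarrow> u' \<in> val M' p) \<and>
      (\<forall>G v. (u, v) \<in> rel_group M G \<longrightarrow> (\<exists>v'. (u', v') \<in> rel_group M' G \<and> (v, v') \<in> Z)) \<and>
      (\<forall>G v'. (u', v') \<in> rel_group M' G \<longrightarrow> (\<exists>v. (u, v) \<in> rel_group M G \<and> (v, v') \<in> Z))"
    by (simp add: assms(3-5))
qed

lemma collective_bisimD:
  assumes "collective_bisim M M' Z" and "(u, u') \<in> Z"
  shows collective_bisim_worlds: "u \<in> worlds M" "u' \<in> worlds M'"
    and collective_bisim_atoms: "u \<in> val M p \<longleftrightarrow> u' \<in> val M' p"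
    and collective_bisim_forth:
      "(u, v) \<in> rel_group M G \<Longrightarrow> \<exists>v'. (u', v') \<in> rel_group M' G \<and> (v, v') \<in> Z"
    and collective_bisim_back:
      "(u', v') \<in> rel_group M' G \<Longrightarrow> \<exists>v. (u, v) \<in> rel_group M G \<and> (v, v') \<in> Z"
proof -
  have sub: "Z \<subseteq> worlds M \<times> worlds M'"
    and all: "\<forall>(u, u') \<in> Z.
      (\<forall>p. u \<in> val M p \<longleftrightarrow> u' \<in> val M' p) \<and>
      (\<forall>G v. (u, v) \<in> rel_group M G \<longrightarrow> (\<exists>v'. (u', v') \<in> rel_group M' G \<and> (v, v') \<in> Z)) \<and>
      (\<forall>G v'. (u', v') \<in> rel_group M' G \<longrightarrow> (\<exists>v. (u, v) \<in> rel_group M G \<and> (v, v') \<in> Z))"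
    using assms(1) unfolding collective_bisim_def by simp_all
  show "u \<in> worlds M" "u' \<in> worlds M'"
    using sub assms(2) by auto
  note clauses = bspec[OF all assms(2), unfolded prod.case]
  show "u \<in> val M p \<longleftrightarrow> u' \<in> val M' p"
    using clauses[THEN conjunct1] by simp
  show "\<exists>v'. (u', v') \<in> rel_group M' G \<and> (v, v') \<in> Z" if "(u, v) \<in> rel_group M G"
    using clauses[THEN conjunct2, THEN conjunct1] that by simp
  show "\<exists>v. (u, v) \<in> rel_group M G \<and> (v, v') \<in> Z" if "(u', v') \<in> rel_group M' G"
    using clauses[THEN conjunct2, THEN conjunct2] that by simp
qed

text \<open>Forth and back are mirror images. This symmetry later yields the back clause for
  announcements from the forth clause alone.\<close>

lemma collective_bisim_converse:
  assumes Z: "collective_bisim M M' Z"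
  shows "collective_bisim M' M (Z\<inverse>)"
proof (rule collective_bisimI)
  show "Z\<inverse> \<noteq> {}" "Z\<inverse> \<subseteq> worlds M' \<times> worlds M"
    using collective_bisim_worlds[OF Z] Z[unfolded collective_bisim_def, THEN conjunct1] by auto
next
  fix u' u p assume "(u', u) \<in> Z\<inverse>"
  then show "u' \<in> val M' p \<longleftrightarrow> u \<in> val M p"
    using collective_bisim_atoms[OF Z, of u u' p] by simp
next
  fix u' u v' G assume "(u', u) \<in> Z\<inverse>" "(u', v') \<in> rel_group M' G"
  then show "\<exists>v. (u, v) \<in> rel_group M G \<and> (v', v) \<in> Z\<inverse>"
    using collective_bisim_back[OF Z, of u u' v' G] by simp
next
  fix u' u v G assume "(u', u) \<in> Z\<inverse>" "(u, v) \<in> rel_group M G"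
  then show "\<exists>v'. (u', v') \<in> rel_group M' G \<and> (v', v) \<in> Z\<inverse>"
    using collective_bisim_forth[OF Z, of u u' v G] by simp
qed

text \<open>The update only removes pairs, so forth for \<open>Z\<close> in the original models
  supplies \<open>v'\<close>; it remains to see that the pair \<open>(u', v')\<close> survives the
  update of \<open>M'\<close>.\<close>

lemma announce_forth:
  assumes Z: "collective_bisim M M' Z"
    and inv: "\<And>u u'. (u, u') \<in> Z \<Longrightarrow> sat \<xi> M u \<longleftrightarrow> sat \<xi> M' u'"
    and uu': "(u, u') \<in> Z" and uv: "(u, v) \<in> rel_group (announce M \<xi>) G"
  shows "\<exists>v'. (u', v') \<in> rel_group (announce M' \<xi>) G \<and> (v, v') \<in> Z"
proof -
  have "(u, v) \<in> rel_group M G"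
    using uv rel_group_announce_subset by blast
  then obtain v' where v': "(u', v') \<in> rel_group M' G" "(v, v') \<in> Z"
    using collective_bisim_forth[OF Z uu'] by blast
  \<comment> \<open>For \<open>G \<noteq> {}\<close>, \<open>u'\<close> agrees with \<open>u\<close>
    on \<open>\<xi>\<close> by \<open>inv\<close>, \<open>u\<close> with \<open>v\<close> by
    \<open>uv\<close>, and \<open>v\<close> with \<open>v'\<close> by \<open>inv\<close> again.
    Membership in \<open>worlds M'\<close> comes from \<open>Z\<close>, and is all that the case
    \<open>G = {}\<close> asks for.\<close>
  then have "(u', v') \<in> rel_group (announce M' \<xi>) G"
    using uv inv[OF uu'] inv[OF v'(2)] collective_bisim_worlds[OF Z uu']
      collective_bisim_worlds[OF Z v'(2)]
    by (auto simp: rel_group_announce agree_iff split: if_splits)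
  with v' show ?thesis by blast
qed

lemma collective_bisim_announce:
  assumes Z: "collective_bisim M M' Z"
    and inv: "\<And>u u'. (u, u') \<in> Z \<Longrightarrow> sat \<xi> M u \<longleftrightarrow> sat \<xi> M' u'"
  shows "collective_bisim (announce M \<xi>) (announce M' \<xi>) Z"
proof -
  have Z_forth: "\<exists>v'. (u', v') \<in> rel_group (announce M' \<xi>) G \<and> (v, v') \<in> Z"
    if "(u, u') \<in> Z" "(u, v) \<in> rel_group (announce M \<xi>) G" for u u' v G
    using announce_forth[OF Z inv that] .
  have Z_back: "\<exists>v. (u, v) \<in> rel_group (announce M \<xi>) G \<and> (v, v') \<in> Z"
    if "(u, u') \<in> Z" "(u', v') \<in> rel_group (announce M' \<xi>) G" for u u' v' G
    \<comment> \<open>Back for \<open>Z\<close> is forth for \<open>Z\<inverse>\<close>, with the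
      two models exchanged.\<close>
    using announce_forth[OF collective_bisim_converse[OF Z], of \<xi> u' u v' G] inv that by auto
  show ?thesis
  proof (rule collective_bisimI)
    show "Z \<noteq> {}" "Z \<subseteq> worlds (announce M \<xi>) \<times> worlds (announce M' \<xi>)"
      using collective_bisim_worlds[OF Z] Z[unfolded collective_bisim_def, THEN conjunct1] by auto
  next
    fix u u' p assume "(u, u') \<in> Z"
    then show "u \<in> val (announce M \<xi>) p \<longleftrightarrow> u' \<in> val (announce M' \<xi>) p"
      using collective_bisim_atoms[OF Z, of u u' p] by simp
  qed (fact Z_forth, fact Z_back)
qed

text \<open>The models vary in the induction because the case \<open>Ann\<close> moves to updated
  ones, while \<open>Z\<close> can stay fixed since announcements preserve it. The case
  \<open>D\<close> includes \<open>G = {}\<close>, as forth and back range over all groups.\<close>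

lemma sat_bisim_invariant:
  assumes "collective_bisim M M' Z" and "(u, u') \<in> Z"
  shows "sat \<psi> M u \<longleftrightarrow> sat \<psi> M' u'"
  using assms
proof (induction \<psi> arbitrary: M M' u u')
  case (Atom p)
  then show ?case by (simp add: collective_bisim_atoms)
next
  case (Neg \<phi>)
  then show ?case by simp
next
  case (Conj \<phi> \<psi>)
  then show ?case by simp
next
  case (D G \<phi>)
  have "sat \<phi> M v \<longleftrightarrow> sat \<phi> M' v'" if "(v, v') \<in> Z" for v v'
    using D.IH[OF D.prems(1) that] .
  then show ?case
    unfolding sat.simps
    using collective_bisim_forth[OF D.prems, of _ G] collective_bisim_back[OF D.prems, of _ G]
    by metis
next
  case (Ann \<xi> \<phi>)
  have "collective_bisim (announce M \<xi>) (announce M' \<xi>) Z"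
    \<comment> \<open>The induction hypothesis for \<open>\<xi>\<close> in the original models, at
      all pairs of \<open>Z\<close>, is the invariance that makes \<open>Z\<close> survive the
      update; the one for \<open>\<phi>\<close> is then used in the updated models.\<close>
    by (rule collective_bisim_announce[OF Ann.prems(1) Ann.IH(1)[OF Ann.prems(1)]])
  then have "sat \<phi> (announce M \<xi>) u \<longleftrightarrow> sat \<phi> (announce M' \<xi>) u'"
    using Ann.IH(2) Ann.prems(2) by simp
  then show ?case
    unfolding sat_Ann using Ann.IH(1)[OF Ann.prems] by simp
qed

theorem theoremA1:
  fixes M :: "('a::finite, 'p::countable, 'w) model"
    and M' :: "('a, 'p, 'v) model"
    and w :: 'w and w' :: 'v
    and \<psi> :: "('a, 'p) fm"
  assumes "is_model M" and "w \<in> worlds M"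
    and "is_model M'" and "w' \<in> worlds M'"
    and "collectively_bisimilar M w M' w'"
    and "\<psi> \<in> LAnn"
  shows "sat \<psi> M w \<longleftrightarrow> sat \<psi> M' w'"
proof -
  obtain Z where "collective_bisim M M' Z" "(w, w') \<in> Z"
    using assms(5) by (auto simp: collectively_bisimilar_def)
  then show ?thesis
    by (rule sat_bisim_invariant)
qed

end
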